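(* Let $k\ge2$, let $Z$ be a random vector in $\mathbb{R}^k$ with mutually independent components, $\mathbb{E}[Z_j]=0$ and $\sigma_j^2:=\mathbb{E}[Z_j^2]\in(0,\infty)$. Suppose each $Z_j$ has a Lebesgue density $p_{Z_j}$ that is strictly positive and twice differentiable with continuous second derivative, and put $$\eta_j:=\bigl(\log p_{Z_j}\bigr)',\qquad j=1,\dots,k .$$ Define $\beta_j:=\mathbb{E}[\eta_j'(Z_j)]$, $\gamma_j:=\mathbb{E}[\eta_j'(Z_j)Z_j^2]$, $\zeta_j:=-\beta_j\sigma_j^2$. Assume that for each $j$: $(1+z^2)p_{Z_j}''\in L^1(\mathbb{R})$; the expectations $\mathbb{E}[\eta_j'(Z_j)]$, $\mathbb{E}[\eta_j'(Z_j)Z_j^2]$ and $\mathbb{E}[\eta_j(Z_j)Z_j]$ converge absolutely; and the boundary conditions $$z\,p_{Z_j}(z)\to0,\qquad z^2\,p_{Z_j}'(z)\to0,\qquad |z|\to\infty,$$ hold. Then $\mathbb{E}[\eta_j(Z_j)Z_j]=-1$ for all $j$, $$\zeta_j=\mathcal{I}(Z_j)\,\sigma_j^2\ \ge\ 1,\qquad \mathcal{I}(Z_j):=\mathbb{E}\bigl[\eta_j(Z_j)^2\bigr],$$ with equality if and only if $Z_j$ is Gaussian, and $\gamma_j<1$. Hence the inequalities $$\gamma_j<1\ \text{ for all } j,\qquad \zeta_j>0\ \text{ for all } j,\qquad \zeta_j\zeta_l>1\ \text{ for all } j\neq l$$ hold if and only if at most one of the random variables $Z_1,\dots,Z_k$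 is Gaussian. *)

theory Defs
  imports "HOL-Probability.Probability"
begin

definition twice_cont_differentiable :: "(real \<Rightarrow> real) \<Rightarrow> bool" where
  "twice_cont_differentiable p \<longleftrightarrow>
     (\<forall>z. p field_differentiable at z) \<and>
     (\<forall>z. deriv p field_differentiable at z) \<and>
     continuous_on UNIV (deriv (deriv p))"

definition score :: "(real \<Rightarrow> real) \<Rightarrow> real \<Rightarrow> real" where
  "score p = deriv (\<lambda>z. ln (p z))"

text \<open>In the following functionals, \<open>p\<close> is meant to be the Lebesgue density of the real random
  variable \<open>X\<close> on the probability space \<open>M\<close>. The derivative of \<open>score p\<close> is taken first and only
  then evaluated at \<open>X\<close>.\<close>

definition beta_coeff :: "'w measure \<Rightarrow> (real \<Rightarrow> real) \<Rightarrow> ('w \<Rightarrow> real) \<Rightarrow> real" where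
  "beta_coeff M p X = (\<integral>\<omega>. deriv (score p) (X \<omega>) \<partial>M)"

definition gamma_coeff :: "'w measure \<Rightarrow> (real \<Rightarrow> real) \<Rightarrow> ('w \<Rightarrow> real) \<Rightarrow> real" where
  "gamma_coeff M p X = (\<integral>\<omega>. deriv (score p) (X \<omega>) * (X \<omega>)\<^sup>2 \<partial>M)"

definition second_moment :: "'w measure \<Rightarrow> ('w \<Rightarrow> real) \<Rightarrow> real" where
  "second_moment M X = (\<integral>\<omega>. (X \<omega>)\<^sup>2 \<partial>M)"

definition zeta_coeff :: "'w measure \<Rightarrow> (real \<Rightarrow> real) \<Rightarrow> ('w \<Rightarrow> real) \<Rightarrow> real" where
  "zeta_coeff M p X = - beta_coeff M p X * second_moment M X"

definition fisher_information :: "'w measure \<Rightarrow> (real \<Rightarrow> real) \<Rightarrow> ('w \<Rightarrow> real) \<Rightarrow> real" where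
  "fisher_information M p X = (\<integral>\<omega>. (score p (X \<omega>))\<^sup>2 \<partial>M)"

definition gaussian :: "'w measure \<Rightarrow> ('w \<Rightarrow> real) \<Rightarrow> bool" where
  "gaussian M X \<longleftrightarrow> (\<exists>\<mu> \<sigma>. 0 < \<sigma> \<and> 
     distributed M lborel X (\<lambda>z. ennreal (normal_density \<mu> \<sigma> z)))"

end

theory Submission
  imports Defs
begin

text \<open>Everything reduces to three integrations by parts for a single component. Write \<open>X\<close> for the
  component, \<open>p\<close> for its density, \<open>\<eta> = p' / p\<close> for its score, and note
  \<open>p'' = p (\<eta>' + \<eta>\<^sup>2)\<close>. A function \<open>G\<close> that vanishes at infinity and has derivative \<open>p g\<close> gives
  \<open>E[g(X)] = 0\<close> (\<open>expectation_eq_0_by_parts\<close>). The three choices of \<open>G\<close> are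

  \<^item> \<open>G = z p\<close>, which gives \<open>E[\<eta>(X) X] = -1\<close>;
  \<^item> \<open>G = p'\<close>, which gives \<open>E[\<eta>'(X)] = -E[\<eta>(X)\<^sup>2]\<close>, so \<open>\<zeta> = I(X) \<sigma>\<^sup>2\<close>;
  \<^item> \<open>G = z\<^sup>2 p' - 2 z p\<close>, which gives \<open>E[\<eta>'(X) X\<^sup>2] = 2 - E[\<eta>(X)\<^sup>2 X\<^sup>2]\<close>.

  Both inequalities then come from completing a square with the first identity:
  \<open>1 - \<gamma> = E[(\<eta>(X) X + 1)\<^sup>2]\<close> and \<open>\<zeta> - 1 = \<sigma>\<^sup>2 E[(\<eta>(X) + X / \<sigma>\<^sup>2)\<^sup>2]\<close>. Since \<open>p\<close> is positive and
  all functions are continuous, such an expectation vanishes only if the squared function is zero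
  at every real number (\<open>expectation_eq_0_imp_eq_0\<close>). For \<open>\<eta>(z) z + 1\<close> this fails at \<open>z = 0\<close>, hence
  \<open>\<gamma> < 1\<close>. For \<open>\<eta>(z) + z / \<sigma>\<^sup>2\<close> it is the differential equation \<open>p' = -(z / \<sigma>\<^sup>2) p\<close>, whose only
  solution of integral 1 is the centred normal density with variance \<open>\<sigma>\<^sup>2\<close>.

  The last equivalence is then arithmetic: numbers \<open>\<zeta>\<^sub>j \<ge> 1\<close> have all their pairwise products above 1
  exactly if at most one of them equals 1.\<close>

section \<open>Integrals over the real line\<close>

lemma integral_derivative_eq_0:
  fixes F f :: "real \<Rightarrow> real"
  assumes "\<And>x. (F has_real_derivative f x) (at x)"
    and "continuous_on UNIV f" and "integrable lborel f"
    and "(F \<longlongrightarrow> 0) at_infinity"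
  shows "(\<integral>x. f x \<partial>lborel) = 0"
proof -
  have "(LBINT x=-\<infinity>..\<infinity>. f x) = 0 - 0"
  proof (rule interval_integral_FTC_integrable)
    show "(F has_vector_derivative f x) (at x)" for x
      using assms(1) by (simp add: has_real_derivative_iff_has_vector_derivative)
    show "isCont f x" for x
      using assms(2) by (simp add: continuous_on_eq_continuous_at)
    show "set_integrable lborel (einterval (-\<infinity>) \<infinity>) f"
      using assms(3) by (simp add: set_integrable_def)
    show "((F \<circ> real_of_ereal) \<longlongrightarrow> 0) (at_right (-\<infinity>))" "((F \<circ> real_of_ereal) \<longlongrightarrow> 0) (at_left \<infinity>)"
      using assms(4) by (auto simp: ereal_tendsto_simps at_infinity_eq_at_top_bot filterlim_sup
          intro: tendsto_mono[rotated])
  qed simp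
  then show ?thesis
    by (simp add: interval_lebesgue_integral_def set_lebesgue_integral_def)
qed

text \<open>The coincidence set of two continuous functions is closed, and a closed set of full Lebesgue
  measure is the whole line.\<close>

lemma AE_lborel_eq_imp_eq:
  fixes f g :: "real \<Rightarrow> real"
  assumes "continuous_on UNIV f" "continuous_on UNIV g" "AE x in lborel. f x = g x"
  shows "f x = g x"
proof -
  have "closed {x. f x = g x}"
    using assms(1,2) by (rule closed_Collect_eq)
  moreover have "AE x in lebesgue. x \<in> {x. f x = g x}"
    using assms(3) by (simp add: AE_completion)
  ultimately show ?thesis
    using mem_closed_if_AE_lebesgue by blast
qed

section \<open>The score of a positive smooth density\<close>

locale positive_C2 =
  fixes p :: "real \<Rightarrow> real"
  assumes pos: "0 < p z"
    and C2: "twice_cont_differentiable p"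
begin

lemma p_deriv: "(p has_real_derivative deriv p z) (at z)"
  using C2 unfolding twice_cont_differentiable_def
  by (simp add: field_differentiable_derivI)

lemma p'_deriv: "(deriv p has_real_derivative deriv (deriv p) z) (at z)"
  using C2 unfolding twice_cont_differentiable_def
  by (simp add: field_differentiable_derivI)

lemma continuous_p: "continuous_on UNIV p"
  using p_deriv by (intro DERIV_continuous_on) (rule has_field_derivative_at_within)

lemma score_eq: "score p z = deriv p z / p z"
  unfolding score_def
  by (rule DERIV_imp_deriv) (auto intro!: derivative_eq_intros p_deriv simp: pos)

lemma score_deriv: "(score p has_real_derivative deriv (deriv p) z / p z - (score p z)\<^sup>2) (at z)"
proof -
  have "((\<lambda>z. deriv p z / p z) has_real_derivative deriv (deriv p) z / p z - (deriv p z / p z)\<^sup>2) (at z)"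
    using pos[of z]
    by (auto intro!: derivative_eq_intros p_deriv p'_deriv simp: field_simps power2_eq_square)
  then show ?thesis
    by (simp add: score_eq[abs_def])
qed

lemma deriv_score: "deriv (score p) z = deriv (deriv p) z / p z - (score p z)\<^sup>2"
  using score_deriv by (rule DERIV_imp_deriv)

lemma continuous_score: "continuous_on UNIV (score p)"
  using score_deriv by (intro DERIV_continuous_on) (rule has_field_derivative_at_within)

lemma continuous_deriv_score: "continuous_on UNIV (deriv (score p))"
proof -
  have "continuous_on UNIV (deriv (deriv p))"
    using C2 by (simp add: twice_cont_differentiable_def)
  moreover have "p z \<noteq> 0" for z
    using pos[of z] by simp
  ultimately show ?thesis
    unfolding deriv_score[abs_def]
    by (intro continuous_on_diff continuous_on_divide continuous_on_power continuous_p continuous_score) auto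
qed

lemmas continuity = continuous_on_add continuous_on_diff continuous_on_mult continuous_on_divide
  continuous_on_power continuous_on_const continuous_on_id
  continuous_p continuous_score continuous_deriv_score

end

section \<open>Integration by parts against the density\<close>

text \<open>A single component: every claim concerns one marginal at a time or numbers computed from the
  marginals.\<close>

locale score_regular_variable = prob_space M + positive_C2 p
  for M :: "'w measure" and X :: "'w \<Rightarrow> real" and p :: "real \<Rightarrow> real" +
  assumes density: "distributed M lborel X (\<lambda>z. ennreal (p z))"
    and mean_zero: "expectation X = 0"
    and var_finite: "integrable M (\<lambda>\<omega>. (X \<omega>)\<^sup>2)"
    and var_pos: "0 < second_moment M X"
    and second_deriv_L1: "integrable lborel (\<lambda>z. (1 + z\<^sup>2) * deriv (deriv p) z)"
    and beta_integrable: "integrable M (\<lambda>\<omega>. deriv (score p) (X \<omega>))"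
    and gamma_integrable: "integrable M (\<lambda>\<omega>. deriv (score p) (X \<omega>) * (X \<omega>)\<^sup>2)"
    and score_integrable: "integrable M (\<lambda>\<omega>. score p (X \<omega>) * X \<omega>)"
    and boundary: "((\<lambda>z. z * p z) \<longlongrightarrow> 0) at_infinity"
    and boundary_deriv: "((\<lambda>z. z\<^sup>2 * deriv p z) \<longlongrightarrow> 0) at_infinity"
begin

lemma integrable_iff_lborel:
  fixes g :: "real \<Rightarrow> real"
  assumes "continuous_on UNIV g"
  shows "integrable M (\<lambda>\<omega>. g (X \<omega>)) \<longleftrightarrow> integrable lborel (\<lambda>z. p z * g z)"
  using pos by (intro distributed_integrable[OF density, symmetric])
    (simp_all add: borel_measurable_continuous_onI[OF assms] less_imp_le)

lemma expectation_eq_lborel: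
  fixes g :: "real \<Rightarrow> real"
  assumes "continuous_on UNIV g"
  shows "expectation (\<lambda>\<omega>. g (X \<omega>)) = (\<integral>z. p z * g z \<partial>lborel)"
  using pos by (intro distributed_integral[OF density, symmetric])
    (simp_all add: borel_measurable_continuous_onI[OF assms] less_imp_le)

text \<open>The expectation is the integral of \<open>G'\<close> over the line, and so the difference of the limits of \<open>G\<close>
  at the two ends. Each integration by parts below is an instance, with \<open>G\<close> as its boundary term.\<close>

lemma expectation_eq_0_by_parts:
  assumes "\<And>z. (G has_real_derivative p z * g z) (at z)"
    and "continuous_on UNIV g" and "integrable M (\<lambda>\<omega>. g (X \<omega>))"
    and "(G \<longlongrightarrow> 0) at_infinity"
  shows "expectation (\<lambda>\<omega>. g (X \<omega>)) = 0"
  unfolding expectation_eq_lborel[OF assms(2)]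
  using assms(3) unfolding integrable_iff_lborel[OF assms(2)]
  by (intro integral_derivative_eq_0[OF assms(1) _ _ assms(4)] continuous_on_mult continuous_p assms(2))

lemma expectation_eq_0_imp_eq_0:
  fixes g :: "real \<Rightarrow> real"
  assumes "continuous_on UNIV g" and "integrable M (\<lambda>\<omega>. g (X \<omega>))"
    and "\<And>z. 0 \<le> g z" and "expectation (\<lambda>\<omega>. g (X \<omega>)) = 0"
  shows "g z = 0"
proof -
  have "integrable lborel (\<lambda>z. p z * g z)" "(\<integral>z. p z * g z \<partial>lborel) = 0"
    using assms(2,4) unfolding integrable_iff_lborel[OF assms(1)] expectation_eq_lborel[OF assms(1)] .
  moreover have "AE z in lborel. 0 \<le> p z * g z"
    using assms(3) pos by (simp add: less_imp_le)
  ultimately have "AE z in lborel. p z * g z = 0"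
    using integral_nonneg_eq_0_iff_AE by blast
  then have "p z * g z = (\<lambda>_. 0) z"
    by (intro AE_lborel_eq_imp_eq[of "\<lambda>z. p z * g z"] continuous_on_mult continuous_on_const
        continuous_p assms(1)) simp
  with pos[of z] show ?thesis
    by simp
qed

text \<open>The integrand \<open>\<eta>' + \<eta>\<^sup>2\<close> is \<open>p'' / p\<close>, so these are the integrability of \<open>p''\<close> and of \<open>z\<^sup>2 p''\<close>,
  both dominated by \<open>(1 + z\<^sup>2) p''\<close>. Together with the integrability of \<open>\<eta>'(X)\<close> and \<open>\<eta>'(X) X\<^sup>2\<close> they make
  \<open>\<eta>(X)\<^sup>2\<close> and \<open>(\<eta>(X) X)\<^sup>2\<close> integrable.\<close>

lemma integrable_second_derivative_ratio:
  "integrable M (\<lambda>\<omega>. deriv (score p) (X \<omega>) + (score p (X \<omega>))\<^sup>2)"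
  "integrable M (\<lambda>\<omega>. (deriv (score p) (X \<omega>) + (score p (X \<omega>))\<^sup>2) * (X \<omega>)\<^sup>2)"
proof -
  have p'': "p z * (deriv (score p) z + (score p z)\<^sup>2) = deriv (deriv p) z" for z
    using pos[of z] by (simp add: deriv_score)
  have [measurable]: "deriv (deriv p) \<in> borel_measurable borel"
    using C2 by (auto simp: twice_cont_differentiable_def intro: borel_measurable_continuous_onI)
  have "integrable lborel (deriv (deriv p))"
    using second_deriv_L1
    by (rule Bochner_Integration.integrable_bound) (auto simp: abs_mult mult_le_cancel_right1)
  moreover have "integrable lborel (\<lambda>z. z\<^sup>2 * deriv (deriv p) z)"
    using second_deriv_L1
    by (rule Bochner_Integration.integrable_bound) (auto simp: abs_mult intro!: mult_right_mono)
  moreover have p''_sq: "p z * ((deriv (score p) z + (score p z)\<^sup>2) * z\<^sup>2) = z\<^sup>2 * deriv (deriv p) z" for z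
    by (simp add: p''[symmetric])
  moreover have "continuous_on UNIV (\<lambda>z. deriv (score p) z + (score p z)\<^sup>2)"
    "continuous_on UNIV (\<lambda>z. (deriv (score p) z + (score p z)\<^sup>2) * z\<^sup>2)"
    by (intro continuity)+
  ultimately show "integrable M (\<lambda>\<omega>. deriv (score p) (X \<omega>) + (score p (X \<omega>))\<^sup>2)"
    "integrable M (\<lambda>\<omega>. (deriv (score p) (X \<omega>) + (score p (X \<omega>))\<^sup>2) * (X \<omega>)\<^sup>2)"
    using integrable_iff_lborel[of "\<lambda>z. deriv (score p) z + (score p z)\<^sup>2"]
      integrable_iff_lborel[of "\<lambda>z. (deriv (score p) z + (score p z)\<^sup>2) * z\<^sup>2"]
    unfolding p'' p''_sq by simp_all
qed

lemma score_square_integrable: "integrable M (\<lambda>\<omega>. (score p (X \<omega>))\<^sup>2)"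
  using Bochner_Integration.integrable_diff[OF integrable_second_derivative_ratio(1) beta_integrable] by simp

lemma score_times_square_integrable: "integrable M (\<lambda>\<omega>. (score p (X \<omega>) * X \<omega>)\<^sup>2)"
  using Bochner_Integration.integrable_diff[OF integrable_second_derivative_ratio(2) gamma_integrable]
  by (simp add: algebra_simps power_mult_distrib)

lemma expectation_score_times: "expectation (\<lambda>\<omega>. score p (X \<omega>) * X \<omega>) = -1"
proof -
  have "expectation (\<lambda>\<omega>. 1 + score p (X \<omega>) * X \<omega>) = 0"
  proof (rule expectation_eq_0_by_parts[of "\<lambda>z. z * p z" "\<lambda>z. 1 + score p z * z"])
    show "((\<lambda>z. z * p z) has_real_derivative p z * (1 + score p z * z)) (at z)" for z
      using pos[of z] by (auto intro!: derivative_eq_intros p_deriv simp: score_eq field_simps)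
  qed (use score_integrable boundary in \<open>auto intro!: continuity\<close>)
  then show ?thesis
    using score_integrable by (simp add: prob_space)
qed

lemma beta_eq: "beta_coeff M p X = - fisher_information M p X"
proof -
  have "expectation (\<lambda>\<omega>. deriv (score p) (X \<omega>) + (score p (X \<omega>))\<^sup>2) = 0"
  proof (rule expectation_eq_0_by_parts[of "deriv p" "\<lambda>z. deriv (score p) z + (score p z)\<^sup>2"])
    show "(deriv p has_real_derivative p z * (deriv (score p) z + (score p z)\<^sup>2)) (at z)" for z
      using pos[of z] p'_deriv[of z] by (simp add: deriv_score)
    \<comment> \<open>Away from 0, \<open>p'\<close> is \<open>z\<^sup>2 p'\<close> divided by \<open>z\<^sup>2\<close>, and both factors \<open>z\<^sup>2 p'\<close> and \<open>1 / z\<^sup>2\<close> tend to 0.\<close>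
    have "((\<lambda>z. (inverse z)\<^sup>2 * (z\<^sup>2 * deriv p z)) \<longlongrightarrow> 0\<^sup>2 * 0) at_infinity"
      by (intro tendsto_intros tendsto_inverse_0 boundary_deriv)
    moreover have "\<forall>\<^sub>F z in at_infinity. (inverse z)\<^sup>2 * (z\<^sup>2 * deriv p z) = deriv p z"
      using eventually_not_equal_at_infinity[of 0]
      by eventually_elim (simp add: field_simps)
    ultimately show "(deriv p \<longlongrightarrow> 0) at_infinity"
      by (simp add: tendsto_cong)
  qed (use integrable_second_derivative_ratio in \<open>auto intro!: continuity\<close>)
  then show ?thesis
    using beta_integrable score_square_integrable
    by (simp add: beta_coeff_def fisher_information_def)
qed

lemma gamma_eq: "gamma_coeff M p X = 2 - expectation (\<lambda>\<omega>. (score p (X \<omega>) * X \<omega>)\<^sup>2)"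
proof -
  define g where "g = (\<lambda>z. (deriv (score p) z + (score p z)\<^sup>2) * z\<^sup>2 - 2)"
  have "expectation (\<lambda>\<omega>. g (X \<omega>)) = 0"
  proof (rule expectation_eq_0_by_parts)
    \<comment> \<open>The term \<open>-2 z p\<close> cancels the \<open>2 z p'\<close> in the derivative of \<open>z\<^sup>2 p'\<close>.\<close>
    show "((\<lambda>z. z\<^sup>2 * deriv p z - 2 * (z * p z)) has_real_derivative p z * g z) (at z)" for z
      using pos[of z]
      by (auto intro!: derivative_eq_intros p_deriv p'_deriv simp: g_def deriv_score field_simps)
    show "((\<lambda>z. z\<^sup>2 * deriv p z - 2 * (z * p z)) \<longlongrightarrow> 0) at_infinity"
      using tendsto_diff[OF boundary_deriv tendsto_mult[OF tendsto_const boundary, of 2]] by simp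
  qed (use integrable_second_derivative_ratio in \<open>auto intro!: continuity simp: g_def\<close>)
  then have "expectation (\<lambda>\<omega>. deriv (score p) (X \<omega>) * (X \<omega>)\<^sup>2 + (score p (X \<omega>) * X \<omega>)\<^sup>2 - 2) = 0"
    by (simp add: g_def algebra_simps power_mult_distrib)
  then show ?thesis
    using gamma_integrable score_times_square_integrable
    by (simp add: gamma_coeff_def prob_space)
qed

section \<open>The bounds on gamma and zeta\<close>

text \<open>The gap \<open>1 - \<gamma>\<close> is \<open>E[(\<eta>(X) X + 1)\<^sup>2]\<close>. It is not zero because the square has the value 1 at the
  origin.\<close>

lemma gamma_less_1: "gamma_coeff M p X < 1"
proof -
  let ?g = "\<lambda>z. (score p z * z + 1)\<^sup>2"
  have g: "(\<lambda>\<omega>. ?g (X \<omega>)) = (\<lambda>\<omega>. (score p (X \<omega>) * X \<omega>)\<^sup>2 + 2 * (score p (X \<omega>) * X \<omega>) + 1)"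
    by (auto simp: power2_eq_square algebra_simps)
  have int: "integrable M (\<lambda>\<omega>. ?g (X \<omega>))"
    unfolding g using score_times_square_integrable score_integrable by auto
  have E: "expectation (\<lambda>\<omega>. ?g (X \<omega>)) = 1 - gamma_coeff M p X"
    unfolding g using score_times_square_integrable score_integrable
    by (simp add: prob_space expectation_score_times gamma_eq)
  have "continuous_on UNIV ?g"
    by (intro continuity)
  then have "expectation (\<lambda>\<omega>. ?g (X \<omega>)) \<noteq> 0"
    using expectation_eq_0_imp_eq_0[of ?g 0] int by auto
  moreover have "expectation (\<lambda>\<omega>. ?g (X \<omega>)) \<ge> 0"
    by simp
  ultimately show ?thesis
    using E by linarith
qed

lemma zeta_eq: "zeta_coeff M p X = fisher_information M p X * second_moment M X"
  by (simp add: zeta_coeff_def beta_eq)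

text \<open>The score of the centred normal law with the variance of \<open>X\<close> is \<open>-z / \<sigma>\<^sup>2\<close>. The excess of \<open>\<zeta>\<close> over 1
  is the scaled mean square distance of the score of \<open>X\<close> from it; this is the equality defect in the
  Cauchy-Schwarz inequality \<open>E[\<eta>(X) X]\<^sup>2 \<le> E[\<eta>(X)\<^sup>2] E[X\<^sup>2]\<close>, whose left side is 1.\<close>

lemma score_linear_defect:
  defines "s2 \<equiv> second_moment M X"
  shows "integrable M (\<lambda>\<omega>. (score p (X \<omega>) + X \<omega> / s2)\<^sup>2)"
    and "s2 * expectation (\<lambda>\<omega>. (score p (X \<omega>) + X \<omega> / s2)\<^sup>2) = zeta_coeff M p X - 1"
proof -
  have sq: "(\<lambda>\<omega>. (score p (X \<omega>) + X \<omega> / s2)\<^sup>2)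
    = (\<lambda>\<omega>. (score p (X \<omega>))\<^sup>2 + 2 / s2 * (score p (X \<omega>) * X \<omega>) + (X \<omega>)\<^sup>2 / s2\<^sup>2)"
    using var_pos by (auto simp: s2_def power2_sum power_divide mult_ac)
  show "integrable M (\<lambda>\<omega>. (score p (X \<omega>) + X \<omega> / s2)\<^sup>2)"
    unfolding sq using score_square_integrable score_integrable var_finite by auto
  have "expectation (\<lambda>\<omega>. (score p (X \<omega>) + X \<omega> / s2)\<^sup>2)
    = fisher_information M p X - 2 / s2 + s2 / s2\<^sup>2"
    unfolding sq using score_square_integrable score_integrable var_finite
    by (simp add: expectation_score_times fisher_information_def s2_def second_moment_def)
  then show "s2 * expectation (\<lambda>\<omega>. (score p (X \<omega>) + X \<omega> / s2)\<^sup>2) = zeta_coeff M p X - 1"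
    using var_pos by (simp add: zeta_eq s2_def field_simps power2_eq_square)
qed

lemma zeta_ge_1: "zeta_coeff M p X \<ge> 1"
proof -
  have "0 \<le> second_moment M X * expectation (\<lambda>\<omega>. (score p (X \<omega>) + X \<omega> / second_moment M X)\<^sup>2)"
    using var_pos by simp
  then show ?thesis
    unfolding score_linear_defect(2) by simp
qed

text \<open>Equality forces \<open>p' = -(z / \<sigma>\<^sup>2) p\<close>. The normal density \<open>q\<close> solves the same equation, so \<open>p / q\<close> is
  constant, and the constant is 1 because both integrate to 1.\<close>

lemma gaussian_if_zeta_eq_1:
  assumes "zeta_coeff M p X = 1"
  shows "gaussian M X"
proof -
  define s2 where "s2 = second_moment M X"
  define q where "q = normal_density 0 (sqrt s2)"
  have s2: "0 < s2"
    using var_pos by (simp add: s2_def)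
  have "expectation (\<lambda>\<omega>. (score p (X \<omega>) + X \<omega> / s2)\<^sup>2) = 0"
    using score_linear_defect(2) var_pos assms by (simp add: s2_def)
  moreover have "continuous_on UNIV (\<lambda>z. (score p z + z / s2)\<^sup>2)"
    using s2 by (intro continuity) auto
  ultimately have "(score p z + z / s2)\<^sup>2 = 0" for z
    using expectation_eq_0_imp_eq_0[of "\<lambda>z. (score p z + z / s2)\<^sup>2" z] score_linear_defect(1)
    by (simp add: s2_def)
  then have ode: "deriv p z = - (z / s2) * p z" for z
    using pos[of z] by (simp add: score_eq add_eq_0_iff2 divide_eq_eq)
  have q_pos: "0 < q z" for z
    using s2 by (simp add: q_def normal_density_pos)
  have q': "(q has_real_derivative - (z / s2) * q z) (at z)" for z
    using s2 unfolding q_def normal_density_def[abs_def]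
    by (auto intro!: derivative_eq_intros simp: field_simps)
  have "((\<lambda>z. p z / q z) has_real_derivative 0) (at z)" for z
    using q_pos[of z] 
    by (auto intro!: derivative_eq_intros p_deriv q' simp: ode)
  then obtain c where c: "p z / q z = c" for z
    using DERIV_isconst_all[of "\<lambda>z. p z / q z"] by blast
  have p: "p z = c * q z" for z
    using c[of z] q_pos[of z] by (simp add: field_simps)
  have "1 = (\<integral>z. p z * 1 \<partial>lborel)"
    using expectation_eq_lborel[of "\<lambda>_. 1"] by (simp add: prob_space)
  also have "\<dots> = c"
    using s2 by (simp add: p q_def)
  finally have "p = q"
    using p by auto
  then show ?thesis
    using density s2 unfolding gaussian_def q_def by (metis real_sqrt_gt_0_iff)
qed

text \<open>A law determines its density only almost everywhere. Continuity makes \<open>p\<close> equal to the normal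
  density at every point, so that the derivative in the score may be computed from the latter.\<close>

lemma zeta_eq_1_if_gaussian:
  assumes "gaussian M X"
  shows "zeta_coeff M p X = 1"
proof -
  obtain m s where s: "0 < s" and normal: "distributed M lborel X (\<lambda>z. ennreal (normal_density m s z))"
    using assms by (auto simp: gaussian_def)
  have m: "m = 0"
    using normal_distributed_expectation[OF s normal] mean_zero by simp
  have s2: "second_moment M X = s\<^sup>2"
    using normal_distributed_variance[OF s normal] mean_zero by (simp add: second_moment_def)
  have "AE z in lborel. ennreal (p z) = ennreal (normal_density m s z)"
    using distributed_unique[OF density normal] .
  then have "AE z in lborel. p z = normal_density m s z"
    by eventually_elim (simp add: pos less_imp_le)
  then have p: "p z = normal_density m s z" for z
    using s by (intro AE_lborel_eq_imp_eq)
      (auto intro!: continuous_intros continuous_p simp: normal_density_def)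
  have score: "score p z = - z / s\<^sup>2" for z
  proof -
    have "(p has_real_derivative - (z / s\<^sup>2) * p z) (at z)"
      using s unfolding p[abs_def] normal_density_def[abs_def] m
      by (auto intro!: derivative_eq_intros simp: field_simps)
    then show ?thesis
      using pos[of z] by (simp add: score_eq DERIV_imp_deriv)
  qed
  have "deriv (score p) z = - 1 / s\<^sup>2" for z
    unfolding score[abs_def] using s
    by (intro DERIV_imp_deriv) (auto intro!: derivative_eq_intros simp: field_simps power2_eq_square)
  then show ?thesis
    using s by (simp add: zeta_coeff_def beta_coeff_def s2 prob_space)
qed

end

section \<open>Counting the Gaussian components\<close>

lemma products_gt_1_iff_card_le_1:
  fixes \<zeta> :: "'k::finite \<Rightarrow> real"
  assumes "\<And>j. 1 \<le> \<zeta> j"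
  shows "(\<forall>j l. j \<noteq> l \<longrightarrow> \<zeta> j * \<zeta> l > 1) \<longleftrightarrow> card {j. \<zeta> j = 1} \<le> 1"
proof -
  have "\<zeta> j * \<zeta> l > 1 \<longleftrightarrow> \<not> (\<zeta> j = 1 \<and> \<zeta> l = 1)" for j l
    using assms[of j] assms[of l] less_1_mult[of "\<zeta> j" "\<zeta> l"] by (cases "\<zeta> j = 1"; cases "\<zeta> l = 1") auto
  then show ?thesis
    by (auto simp: card_le_Suc0_iff_eq)
qed

theorem corollary7p23:
  fixes M :: "'w measure"
    and Z :: "'w \<Rightarrow> real ^ 'k"
    and p :: "'k \<Rightarrow> real \<Rightarrow> real"
  assumes k: "CARD('k) \<ge> 2"
    and M: "prob_space M"
    and Z: "Z \<in> borel_measurable M"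
    and indep: "prob_space.indep_vars M (\<lambda>_. borel) (\<lambda>j \<omega>. Z \<omega> $ j) UNIV"
    and mean_integrable: "\<And>j. integrable M (\<lambda>\<omega>. Z \<omega> $ j)"
    and mean_zero: "\<And>j. (\<integral>\<omega>. Z \<omega> $ j \<partial>M) = 0"
    and var_finite: "\<And>j. integrable M (\<lambda>\<omega>. (Z \<omega> $ j)\<^sup>2)"
    and var_pos: "\<And>j. 0 < second_moment M (\<lambda>\<omega>. Z \<omega> $ j)"
    and density: "\<And>j. distributed M lborel (\<lambda>\<omega>. Z \<omega> $ j) (\<lambda>z. ennreal (p j z))"
    and density_pos: "\<And>j z. 0 < p j z"
    and density_C2: "\<And>j. twice_cont_differentiable (p j)"
    and second_deriv_L1: "\<And>j. integrable lborel (\<lambda>z. (1 + z\<^sup>2) * deriv (deriv (p j)) z)"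
    and beta_integrable: "\<And>j. integrable M (\<lambda>\<omega>. deriv (score (p j)) (Z \<omega> $ j))"
    and gamma_integrable: "\<And>j. integrable M (\<lambda>\<omega>. deriv (score (p j)) (Z \<omega> $ j) * (Z \<omega> $ j)\<^sup>2)"
    and score_integrable: "\<And>j. integrable M (\<lambda>\<omega>. score (p j) (Z \<omega> $ j) * Z \<omega> $ j)"
    and boundary: "\<And>j. ((\<lambda>z. z * p j z) \<longlongrightarrow> 0) at_infinity"
    and boundary_deriv: "\<And>j. ((\<lambda>z. z\<^sup>2 * deriv (p j) z) \<longlongrightarrow> 0) at_infinity"
  shows "(\<forall>j. (\<integral>\<omega>. score (p j) (Z \<omega> $ j) * Z \<omega> $ j \<partial>M) = -1)
    \<and> (\<forall>j. zeta_coeff M (p j) (\<lambda>\<omega>. Z \<omega> $ j) =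
             fisher_information M (p j) (\<lambda>\<omega>. Z \<omega> $ j) * second_moment M (\<lambda>\<omega>. Z \<omega> $ j)
         \<and> zeta_coeff M (p j) (\<lambda>\<omega>. Z \<omega> $ j) \<ge> 1
         \<and> (zeta_coeff M (p j) (\<lambda>\<omega>. Z \<omega> $ j) = 1 \<longleftrightarrow> gaussian M (\<lambda>\<omega>. Z \<omega> $ j)))
    \<and> (\<forall>j. gamma_coeff M (p j) (\<lambda>\<omega>. Z \<omega> $ j) < 1)
    \<and> (((\<forall>j. gamma_coeff M (p j) (\<lambda>\<omega>. Z \<omega> $ j) < 1)
         \<and> (\<forall>j. zeta_coeff M (p j) (\<lambda>\<omega>. Z \<omega> $ j) > 0)
         \<and> (\<forall>j l. j \<noteq> l \<longrightarrow>
              zeta_coeff M (p j) (\<lambda>\<omega>. Z \<omega> $ j) * zeta_coeff M (p l) (\<lambda>\<omega>. Z \<omega> $ l) > 1))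
       \<longleftrightarrow> card {j. gaussian M (\<lambda>\<omega>. Z \<omega> $ j)} \<le> 1)"
proof -
  have "score_regular_variable M (\<lambda>\<omega>. Z \<omega> $ j) (p j)" for j
    using assms by (intro score_regular_variable.intro positive_C2.intro score_regular_variable_axioms.intro) auto
  note component = score_regular_variable.expectation_score_times[OF this]
    score_regular_variable.zeta_eq[OF this] score_regular_variable.zeta_ge_1[OF this]
    score_regular_variable.gaussian_if_zeta_eq_1[OF this]
    score_regular_variable.zeta_eq_1_if_gaussian[OF this]
    score_regular_variable.gamma_less_1[OF this]
  have gaussian_iff: "gaussian M (\<lambda>\<omega>. Z \<omega> $ j) \<longleftrightarrow> zeta_coeff M (p j) (\<lambda>\<omega>. Z \<omega> $ j) = 1" for j
    using component(4,5) by blast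
  have zeta_pos: "0 < zeta_coeff M (p j) (\<lambda>\<omega>. Z \<omega> $ j)" for j
    using component(3)[of j] by linarith
  show ?thesis
    unfolding gaussian_iff
    using products_gt_1_iff_card_le_1[of "\<lambda>j. zeta_coeff M (p j) (\<lambda>\<omega>. Z \<omega> $ j)", OF component(3)]
    by (intro conjI allI component(1,2,3,6) refl) (simp add: component(6) zeta_pos)
qed

end
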